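(* Let $(Y,d,\mu)$ be a doubling quasi metric space, let $\Omega\subseteq Y$ be open, and let $\mathcal{S}_\Omega$, $\mathcal{L}(\Omega)$ and $\mathbb{K}_{\Omega,f}$ be as in the context. Suppose that $\mathbb{K}_{\Omega,f}$ satisfies the power decay property $PD(M,\gamma,\varepsilon_P,\eta_P)$ for every $f\in\mathcal{L}(\Omega)$. Then there exists a positive structural constant $C$ such that, for every $f\in\mathcal{L}(\Omega)$, every ball $B_{\eta R}(x_0)\subset\Omega$ and every $u\in\mathbb{K}_{\Omega,f}(B_{\eta R}(x_0))$ that is nonnegative and locally bounded, $$\sup_{B_R(x_0)}u\le C\Bigl(\inf_{B_R(x_0)}u+\mathcal{S}_\Omega(B_{\eta R}(x_0),f)\Bigr),$$ where $\eta=2K(2K\eta_P+1)$ and $K$ is the constant in the quasi triangle inequality.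
   Context: Quasi metric spaces. A quasi distance on a nonempty set $Y$ is a function $d:Y\times Y\to[0,+\infty[$ that is symmetric, satisfies $d(x,y)=0$ if and only if $x=y$, and satisfies the quasi triangle inequality $d(x,y)\le K(d(x,z)+d(z,y))$ for all $x,y,z\in Y$, with a constant $K\ge1$. Balls are $B_r(x)=\{y\in Y:d(x,y)<r\}$; $Y$ carries the topology induced by $d$, for which the balls form a basis of neighborhoods. A positive measure $\mu$ on a $\sigma$-algebra containing the balls is doubling if there is $C_D>0$ with $0<\mu(B_{2r}(x))\le C_D\,\mu(B_r(x))$ for all $x\in Y$, $r>0$; then $(Y,d,\mu)$ is called a doubling quasi metric space. The function $\mathcal{S}_\Omega$. Let $\mathcal{B}$ be the set of balls $B_r(x)$, $x\in\Omega$, $r>0$, contained in $\Omega$, and $\mathcal{F}(\Omega)$ the set of measurable functions $f:\Omega\to\mathbb{R}$. A function $\mathcal{S}_\Omega:\mathcal{B}\times\mathcal{F}(\Omega)\to[0,+\infty[$ is fixed such that $\mathcal{S}_\Omega(B_r(y),f)\le\mathcal{S}_\Omega(B_R(x),f)$ whenever $B_r(y)\subseteq B_R(x)$, and $\mathcal{S}_\Omega(B,\lambda f)=|\lambda|\,\mathcal{S}_\Omega(B,f)$ for all $\lambda\in\mathbb{R}$. $\mathcal{L}(\Omega)$ is the set of $f\in\mathcal{F}(\Omega)$ with $\mathcal{S}_\Omega(B,f)<+\infty$ for every ball $B\subseteq\Omega$. The families. For each $f\in\mathcal{L}(\Omega)$, $\mathbb{K}_{\Omega,f}$ is a family of nonnegative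 measurable functions $u:A\to\mathbb{R}$ with domains $A\subset\Omega$, such that: (i) if $u\in\mathbb{K}_{\Omega,f}$ then $\lambda u\in\mathbb{K}_{\Omega,\lambda f}$ for all $\lambda\ge0$; (ii) if $u\in\mathbb{K}_{\Omega,f}$ then $\tau-\lambda u\in\mathbb{K}_{\Omega,-\lambda f}$ for all $\lambda,\tau\ge0$ such that $\tau-\lambda u\ge0$. One writes $u\in\mathbb{K}_{\Omega,f}(A)$ if $u\in\mathbb{K}_{\Omega,f}$ and the domain of $u$ contains $A$. Structural constant. A constant is structural if it is independent of each $u$ belonging to $\mathbb{K}_{\Omega,f}$, of $f\in\mathcal{L}(\Omega)$ and of the balls of the quasi distance. Power decay. $\mathbb{K}_{\Omega,f}$ satisfies $PD(M,\gamma,\varepsilon_P,\eta_P)$, where $0<\gamma,\varepsilon_P<1$ and $\eta_P,M>1$ are structural constants, if (all balls having the same arbitrary center) for each $u\in\mathbb{K}_{\Omega,f}(B_{\eta_PR})$ with $\inf_{B_R}u\le1$ and $\mathcal{S}_\Omega(B_{\eta_PR},f)<\varepsilon_P$ one has $\mu(\{x\in B_{R/2}:u(x)>M^k\})\le\gamma^k\,\mu(B_{R/2})$ for every $k\in\mathbb{N}$.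
   Formalization: Added, as the claim fails without each: balls have finite measure; (ii) also gives τ−λu on any open subset of the domain of u where it is ≥0; "locally bounded" means bounded on bounded sets at positive distance from the complement of the ball (the usual notion if Y is complete). *)

theory Defs
  imports "HOL-Analysis.Analysis"
begin

definition quasi_distance :: "('a \<Rightarrow> 'a \<Rightarrow> real) \<Rightarrow> real \<Rightarrow> bool" where
  "quasi_distance d K \<longleftrightarrow>
     1 \<le> K \<and>
     (\<forall>x y. 0 \<le> d x y \<and> d x y = d y x \<and> (d x y = 0 \<longleftrightarrow> x = y)) \<and>
     (\<forall>x y z. d x y \<le> K * (d x z + d z y))"

definition qball :: "('a \<Rightarrow> 'a \<Rightarrow> real) \<Rightarrow> 'a \<Rightarrow> real \<Rightarrow> 'a set" where
  "qball d x r = {y. d x y < r}"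

(* The topology induced by d.  Quasi balls are neighbourhoods of their centres in it,
   but need not themselves be open. *)
definition qopen :: "('a \<Rightarrow> 'a \<Rightarrow> real) \<Rightarrow> 'a set \<Rightarrow> bool" where
  "qopen d U \<longleftrightarrow> (\<forall>x\<in>U. \<exists>r>0. qball d x r \<subseteq> U)"

(* The space Y is the whole type.  Balls have finite measure: the doubling inequality is one
   between positive real numbers (a measure that is infinite on every ball would otherwise be
   doubling, and would make power decay vacuous). *)
definition doubling_quasi_metric_space ::
    "('a \<Rightarrow> 'a \<Rightarrow> real) \<Rightarrow> real \<Rightarrow> 'a measure \<Rightarrow> bool" where
  "doubling_quasi_metric_space d K \<mu> \<longleftrightarrow>
     quasi_distance d K \<and>
     space \<mu> = UNIV \<and>
     (\<forall>x. \<forall>r>0. qball d x r \<in> sets \<mu>) \<and>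
     (\<forall>x. \<forall>r>0. emeasure \<mu> (qball d x r) < \<infinity>) \<and>
     (\<exists>C\<^sub>D::real. C\<^sub>D > 0 \<and>
        (\<forall>x. \<forall>r>0. 0 < emeasure \<mu> (qball d x (2 * r)) \<and>
           emeasure \<mu> (qball d x (2 * r)) \<le> ennreal C\<^sub>D * emeasure \<mu> (qball d x r)))"

definition balls_in :: "('a \<Rightarrow> 'a \<Rightarrow> real) \<Rightarrow> 'a set \<Rightarrow> 'a set set" where
  "balls_in d \<Omega> = {qball d x r | x r. x \<in> \<Omega> \<and> 0 < r \<and> qball d x r \<subseteq> \<Omega>}"

(* Measurable functions A -> R, for the trace sigma-algebra on A; functions with domain A are
   represented by their extensional total versions. *)
definition measurable_funs :: "'a measure \<Rightarrow> 'a set \<Rightarrow> ('a \<Rightarrow> real) set" where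
  "measurable_funs \<mu> A = borel_measurable (restrict_space \<mu> A) \<inter> extensional A"

(* The values of S are taken in [0, +oo], so that the finiteness requirement defining
   S_finite_funs is meaningful; S with values in [0, +oo) is a special case. *)
definition ball_functional ::
    "('a \<Rightarrow> 'a \<Rightarrow> real) \<Rightarrow> 'a measure \<Rightarrow> 'a set \<Rightarrow> ('a set \<Rightarrow> ('a \<Rightarrow> real) \<Rightarrow> ennreal) \<Rightarrow> bool" where
  "ball_functional d \<mu> \<Omega> S \<longleftrightarrow>
     (\<forall>f\<in>measurable_funs \<mu> \<Omega>. \<forall>B\<in>balls_in d \<Omega>. \<forall>B'\<in>balls_in d \<Omega>.
        B' \<subseteq> B \<longrightarrow> S B' f \<le> S B f) \<and>
     (\<forall>f\<in>measurable_funs \<mu> \<Omega>. \<forall>B\<in>balls_in d \<Omega>. \<forall>c::real.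
        S B (\<lambda>x\<in>\<Omega>. c * f x) = ennreal \<bar>c\<bar> * S B f)"

definition S_finite_funs ::
    "('a \<Rightarrow> 'a \<Rightarrow> real) \<Rightarrow> 'a measure \<Rightarrow> 'a set \<Rightarrow> ('a set \<Rightarrow> ('a \<Rightarrow> real) \<Rightarrow> ennreal) \<Rightarrow>
     ('a \<Rightarrow> real) set" where
  "S_finite_funs d \<mu> \<Omega> S = {f \<in> measurable_funs \<mu> \<Omega>. \<forall>B\<in>balls_in d \<Omega>. S B f < \<infinity>}"

(* A member u : A -> R of the family attached to f is the pair (A, u).
   In the last clause the sign condition is understood on the domain A' on which
   \<tau> - \<lambda> u is considered, which may be the domain A of u or any open subset of it.
   This localisation is essential: with A' = A only, the clause says nothing about functions u
   that are unbounded on A, however small the ball on which u is studied. *)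
definition admissible_families ::
    "('a \<Rightarrow> 'a \<Rightarrow> real) \<Rightarrow> 'a measure \<Rightarrow> 'a set \<Rightarrow> ('a set \<Rightarrow> ('a \<Rightarrow> real) \<Rightarrow> ennreal) \<Rightarrow>
     (('a \<Rightarrow> real) \<Rightarrow> ('a set \<times> ('a \<Rightarrow> real)) set) \<Rightarrow> bool" where
  "admissible_families d \<mu> \<Omega> S \<K> \<longleftrightarrow>
     (\<forall>f\<in>S_finite_funs d \<mu> \<Omega> S. \<forall>(A, u)\<in>\<K> f.
        A \<subseteq> \<Omega> \<and> u \<in> measurable_funs \<mu> A \<and> (\<forall>x\<in>A. 0 \<le> u x)) \<and>
     (\<forall>f\<in>S_finite_funs d \<mu> \<Omega> S. \<forall>(A, u)\<in>\<K> f. \<forall>l\<ge>0.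
        (A, \<lambda>x\<in>A. l * u x) \<in> \<K> (\<lambda>x\<in>\<Omega>. l * f x)) \<and>
     (\<forall>f\<in>S_finite_funs d \<mu> \<Omega> S. \<forall>(A, u)\<in>\<K> f. \<forall>l\<ge>0. \<forall>t\<ge>0. \<forall>A'\<subseteq>A.
        (A' = A \<or> qopen d A') \<and> (\<forall>x\<in>A'. 0 \<le> t - l * u x) \<longrightarrow>
        (A', \<lambda>x\<in>A'. t - l * u x) \<in> \<K> (\<lambda>x\<in>\<Omega>. - l * f x))"

definition power_decay ::
    "('a \<Rightarrow> 'a \<Rightarrow> real) \<Rightarrow> 'a measure \<Rightarrow> ('a set \<Rightarrow> ('a \<Rightarrow> real) \<Rightarrow> ennreal) \<Rightarrow>
     (('a \<Rightarrow> real) \<Rightarrow> ('a set \<times> ('a \<Rightarrow> real)) set) \<Rightarrow> ('a \<Rightarrow> real) \<Rightarrow>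
     real \<Rightarrow> real \<Rightarrow> real \<Rightarrow> real \<Rightarrow> bool" where
  "power_decay d \<mu> S \<K> f M \<gamma> \<epsilon> \<eta> \<longleftrightarrow>
     1 < M \<and> 0 < \<gamma> \<and> \<gamma> < 1 \<and> 0 < \<epsilon> \<and> \<epsilon> < 1 \<and> 1 < \<eta> \<and>
     (\<forall>x. \<forall>R>0. \<forall>(A, u)\<in>\<K> f.
        qball d x (\<eta> * R) \<subseteq> A \<and>
        (INF y\<in>qball d x R. u y) \<le> 1 \<and>
        S (qball d x (\<eta> * R)) f < ennreal \<epsilon> \<longrightarrow>
        (\<forall>k::nat. emeasure \<mu> {y \<in> qball d x (R / 2). M ^ k < u y}
                   \<le> ennreal (\<gamma> ^ k) * emeasure \<mu> (qball d x (R / 2))))"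

(* Local boundedness on A in the sense of "bounded on every E compactly inside A": E is bounded
   and at positive distance from the complement of A.  If Y is complete (hence, being doubling,
   has compact closed bounded sets) and A is open, this is the same as boundedness near each
   point of A; without completeness the pointwise notion does not prevent u from blowing up
   at a missing point of Y. *)
definition locally_bounded_on ::
    "('a \<Rightarrow> 'a \<Rightarrow> real) \<Rightarrow> 'a set \<Rightarrow> ('a \<Rightarrow> real) \<Rightarrow> bool" where
  "locally_bounded_on d A u \<longleftrightarrow>
     (\<forall>E\<subseteq>A. (\<exists>x r. E \<subseteq> qball d x r) \<and> (\<exists>s>0. \<forall>y\<in>E. qball d y s \<subseteq> A)
        \<longrightarrow> bounded (u ` E))"

end

theory Submission
  imports Defs
begin

text \<open>
  After scaling one may assume \<open>inf u \<le> 1\<close> and \<open>S f < \<epsilon>\<^sub>P\<close>, and has to bound \<open>u\<close> by a structural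
  constant \<open>T\<close> on \<open>B\<^sub>R\<close>.  Let \<open>u x \<ge> t\<close> with \<open>t\<close> large and let \<open>B\<close> be a small ball about \<open>x\<close>.
  Power decay of \<open>u\<close> makes \<open>{u > t/2}\<close> a small part of \<open>B\<close>.  If \<open>u \<le> \<nu> t\<close> near \<open>B\<close> with \<open>\<nu>\<close> close to
  \<open>1\<close>, then power decay of \<open>(\<nu> t - u) / ((\<nu> - 1) t)\<close> makes \<open>{u \<le> t/2}\<close> a small part of \<open>B\<close> too,
  which is absurd; so \<open>u\<close> exceeds \<open>\<nu> t\<close> near \<open>x\<close>.  The radius of \<open>B\<close> may decrease geometrically as
  \<open>t\<close> increases, so iteration from a point with \<open>u x > T\<close> never leaves \<open>B\<^bsub>2KR\<^esub>\<close>, contradicting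
  local boundedness.
\<close>

section \<open>Quasi balls\<close>

lemma qball_subset_qball:
  assumes "quasi_distance d K" and "d x y \<le> r" and "K * (r + s) \<le> q"
  shows "qball d y s \<subseteq> qball d x q"
proof
  fix z assume "z \<in> qball d y s"
  then have "d y z < s" by (simp add: qball_def)
  moreover have "d x z \<le> K * (d x y + d y z)" and "K > 0"
    using assms(1) unfolding quasi_distance_def by (blast, linarith)
  ultimately have "d x z < K * (r + s)"
    using assms(2) by (smt (verit) mult_less_cancel_left_pos)
  then show "z \<in> qball d x q"
    using assms(3) by (simp add: qball_def)
qed

lemma qball_mono: "r \<le> s \<Longrightarrow> qball d x r \<subseteq> qball d x s"
  by (auto simp: qball_def)

lemma centre_in_qball: "quasi_distance d K \<Longrightarrow> 0 < r \<Longrightarrow> x \<in> qball d x r"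
  unfolding quasi_distance_def qball_def by (metis mem_Collect_eq)

text \<open>Quasi balls need not be open, so open subdomains are obtained as interiors. The radius
  \<open>r / (2 * K)\<close> is chosen so that two of them, added and multiplied by
  \<open>K\<close>, give \<open>r\<close>.\<close>

lemma qopen_interior:
  assumes "quasi_distance d K"
  shows "qopen d {y. \<exists>r>0. qball d y r \<subseteq> E}"
  unfolding qopen_def
proof (intro ballI)
  fix y assume "y \<in> {y. \<exists>r>0. qball d y r \<subseteq> E}"
  then obtain r where r: "r > 0" "qball d y r \<subseteq> E" by blast
  have K: "K \<ge> 1" using assms by (simp add: quasi_distance_def)
  define s where "s = r / (2 * K)"
  have s: "s > 0" "K * (s + s) = r" using K r by (simp_all add: s_def)
  have "qball d z s \<subseteq> E" if "z \<in> qball d y s" for z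
  proof -
    have "d y z \<le> s" using that by (simp add: qball_def)
    then show ?thesis using qball_subset_qball[OF assms, of y z s s r] s r by auto
  qed
  then show "\<exists>r>0. qball d y r \<subseteq> {y. \<exists>r>0. qball d y r \<subseteq> E}"
    using s by blast
qed

section \<open>Chains of growth steps\<close>

text \<open>Each step is appended at the end of the chain: if the point reached lies within
  \<open>b\<close>, the ball of the next step lies within \<open>K * (b + a)\<close>, hence within
  \<open>2 * K * b\<close>. Since \<open>step\<close> admits every \<open>s\<close> up to
  \<open>u x\<close>, the guaranteed height can be followed instead of the actual values of
  \<open>u\<close>.\<close>

lemma chained_growth:
  fixes u :: "'a \<Rightarrow> real"
  assumes qd: "quasi_distance d K"
    and a: "a > 0" and t: "t > 0" and nu: "\<nu> > 1"
    and step: "\<And>x s. qball d x a \<subseteq> G \<Longrightarrow> t \<le> s \<Longrightarrow> s \<le> u x \<Longrightarrow> \<exists>y\<in>qball d x a. \<nu> * s \<le> u y"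
    and ball: "qball d x ((2 * K) ^ L * a) \<subseteq> G" and ux: "t \<le> u x"
  shows "\<exists>y\<in>qball d x ((2 * K) ^ L * a). \<nu> ^ L * t \<le> u y"
  using ball
proof (induction L)
  case 0
  then show ?case using centre_in_qball[OF qd a] ux by auto
next
  case (Suc L)
  have K: "K \<ge> 1" using qd by (simp add: quasi_distance_def)
  define b where "b = (2 * K) ^ L * a"
  have b: "a \<le> b"
    using K a one_le_power[of "2 * K" L] by (simp add: b_def)
  have Sb: "(2 * K) ^ Suc L * a = K * (b + b)" by (simp add: b_def)
  have "b * 1 \<le> b * (2 * K)" using K b a by (intro mult_left_mono) auto
  then have "qball d x b \<subseteq> qball d x ((2 * K) ^ Suc L * a)"
    unfolding Sb by (intro qball_mono) (simp add: algebra_simps)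
  then obtain y where y: "y \<in> qball d x b" "\<nu> ^ L * t \<le> u y"
    using Suc unfolding b_def by blast
  have "qball d y a \<subseteq> qball d x ((2 * K) ^ Suc L * a)"
    unfolding Sb
    by (rule qball_subset_qball[OF qd, of x y b]) (use y b K in \<open>auto simp: qball_def\<close>)
  moreover have "t \<le> \<nu> ^ L * t"
    using nu t by (simp add: one_le_power)
  moreover have "\<nu> ^ Suc L * t = \<nu> * (\<nu> ^ L * t)" by simp
  ultimately show ?case
    using step[of y "\<nu> ^ L * t"] y Suc.prems by (metis subset_iff)
qed

text \<open>The factor \<open>(2 K)\<^sup>L\<close> absorbs the losses of the quasi triangle inequality in \<open>L\<close> growth steps
  with the same radius, after which the radius may shrink by the factor \<open>\<theta> \<ge> 2 K\<close>.\<close>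

lemma unbounded_of_growth:
  fixes u :: "'a \<Rightarrow> real"
  assumes qd: "quasi_distance d K"
    and a: "a > 0" and T: "T > 0" and nu: "\<nu> > 1"
    and theta: "2 * K \<le> \<theta>" and H: "1 < H" "H \<le> \<nu> ^ L"
    and step: "\<And>j x s. qball d x (a / \<theta> ^ j) \<subseteq> G \<Longrightarrow> T * H ^ j \<le> s \<Longrightarrow> s \<le> u x
                 \<Longrightarrow> \<exists>y\<in>qball d x (a / \<theta> ^ j). \<nu> * s \<le> u y"
    and ball: "qball d x (2 * K * ((2 * K) ^ L * a)) \<subseteq> G" and ux: "T \<le> u x"
  shows "\<not> (\<exists>b. \<forall>y\<in>G. u y \<le> b)"
proof -
  have K: "K \<ge> 1" using qd by (simp add: quasi_distance_def)
  have th: "\<theta> > 0" using theta K by linarith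
  \<comment> \<open>\<open>\<rho> j\<close> bounds the region visited in round \<open>j\<close>,
    which consists of \<open>L\<close> steps of size \<open>a / \<theta> ^ j\<close> and raises the
    height by the factor \<open>H\<close>.\<close>
  define \<rho> where "\<rho> = (\<lambda>j. (2 * K) ^ L * (a / \<theta> ^ j))"
  have rho: "\<rho> j > 0" for j using K a th by (simp add: \<rho>_def)
  have rho_Suc: "2 * K * \<rho> (Suc j) \<le> \<rho> j" for j
  proof -
    have "\<rho> j = \<theta> * \<rho> (Suc j)" using th by (simp add: \<rho>_def)
    then show ?thesis using theta rho[of "Suc j"] by simp
  qed
  \<comment> \<open>The factor \<open>2 * K\<close> reserves room for all later rounds. The level
    \<open>j\<close> stays free because the induction on \<open>n\<close> restarts from a new centre
    at level \<open>Suc j\<close>.\<close>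
  have climb: "\<exists>y\<in>G. T * H ^ (j + n) \<le> u y"
    if "qball d x (2 * K * \<rho> j) \<subseteq> G" "T * H ^ j \<le> u x" for n j x
    using that
  proof (induction n arbitrary: j x)
    case 0
    have "x \<in> qball d x (2 * K * \<rho> j)"
      using K rho[of j] by (intro centre_in_qball[OF qd]) auto
    then show ?case using 0 by auto
  next
    case (Suc n)
    have "\<rho> j * 1 \<le> \<rho> j * (2 * K)" using K rho[of j] by (intro mult_left_mono) auto
    then have "qball d x (\<rho> j) \<subseteq> G"
      using Suc.prems(1) qball_mono[of "\<rho> j" "2 * K * \<rho> j" d x] by (auto simp: mult.commute)
    then have "\<exists>y\<in>qball d x (\<rho> j). \<nu> ^ L * (T * H ^ j) \<le> u y"
      using Suc.prems(2) a th T H unfolding \<rho>_def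
      by (intro chained_growth[OF qd _ _ nu step]) auto
    then obtain y where y: "y \<in> qball d x (\<rho> j)" "\<nu> ^ L * (T * H ^ j) \<le> u y" by blast
    have "qball d y (2 * K * \<rho> (Suc j)) \<subseteq> qball d x (2 * K * \<rho> j)"
    proof (rule qball_subset_qball[OF qd, of x y "\<rho> j"])
      show "d x y \<le> \<rho> j" using y by (simp add: qball_def)
      have "K * (2 * K * \<rho> (Suc j)) \<le> K * \<rho> j"
        using rho_Suc[of j] K by (intro mult_left_mono) auto
      then show "K * (\<rho> j + 2 * K * \<rho> (Suc j)) \<le> 2 * K * \<rho> j"
        by (simp add: algebra_simps)
    qed
    moreover have "T * H ^ Suc j \<le> u y"
    proof -
      have "H * (T * H ^ j) \<le> \<nu> ^ L * (T * H ^ j)"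
        using H T by (intro mult_right_mono) auto
      then show ?thesis using y by (simp add: algebra_simps)
    qed
    ultimately have "\<exists>y\<in>G. T * H ^ (Suc j + n) \<le> u y"
      using Suc.IH[of y "Suc j"] Suc.prems(1) by blast
    then show ?case by simp
  qed
  show ?thesis
  proof
    assume "\<exists>b. \<forall>y\<in>G. u y \<le> b"
    then obtain b where b: "\<And>y. y \<in> G \<Longrightarrow> u y \<le> b" by blast
    obtain n where n: "b / T < H ^ n" using real_arch_pow[OF H(1)] by blast
    have "\<exists>y\<in>G. T * H ^ (0 + n) \<le> u y"
      by (rule climb[of x]) (use ball ux in \<open>simp_all add: \<rho>_def\<close>)
    then show False using b n T by (force simp: field_simps)
  qed
qed

section \<open>Doubling measures\<close>

lemma emeasure_qball_power:
  assumes "\<And>x r. r > 0 \<Longrightarrow> emeasure \<mu> (qball d x (2 * r)) \<le> ennreal C * emeasure \<mu> (qball d x r)"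
    and "C \<ge> 0" and "r > 0"
  shows "emeasure \<mu> (qball d x (2 ^ p * r)) \<le> ennreal (C ^ p) * emeasure \<mu> (qball d x r)"
proof (induction p)
  case 0
  then show ?case by simp
next
  case (Suc p)
  have "emeasure \<mu> (qball d x (2 ^ Suc p * r)) \<le> ennreal C * emeasure \<mu> (qball d x (2 ^ p * r))"
    using assms(1)[of "2 ^ p * r" x] assms(3) by (simp add: mult.assoc)
  also have "\<dots> \<le> ennreal C * (ennreal (C ^ p) * emeasure \<mu> (qball d x r))"
    using Suc by (intro mult_left_mono) auto
  also have "\<dots> = ennreal (C ^ Suc p) * emeasure \<mu> (qball d x r)"
    using assms(2) by (simp add: ennreal_mult mult.assoc)
  finally show ?case .
qed

text \<open>The domain \<open>A\<close> itself may fail to be measurable. A preimage under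
  \<open>u\<close> is the trace on \<open>A\<close> of a measurable set \<open>E\<close>, and inside
  the measurable set \<open>B\<close> the trace agrees with \<open>E\<close>.\<close>

lemma sets_Collect_measurable_funs:
  assumes u: "u \<in> measurable_funs \<mu> A" and B: "B \<in> sets \<mu>" "B \<subseteq> A" and Y: "Y \<in> sets borel"
  shows "{y \<in> B. u y \<in> Y} \<in> sets \<mu>"
proof -
  have "u -` Y \<inter> space (restrict_space \<mu> A) \<in> sets (restrict_space \<mu> A)"
    using u Y unfolding measurable_funs_def by (auto intro: measurable_sets)
  then obtain E where E: "E \<in> sets \<mu>" "u -` Y \<inter> (A \<inter> space \<mu>) = A \<inter> E"
    by (auto simp: sets_restrict_space space_restrict_space)
  have "B \<subseteq> space \<mu>" using B(1) by (rule sets.sets_into_space)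
  then have "{y \<in> B. u y \<in> Y} = B \<inter> E" using E(2) B(2) by blast
  then show ?thesis using E B by auto
qed

section \<open>Families with power decay\<close>

text \<open>\<open>\<kappa>\<close> is the enlargement factor \<open>\<eta>\<^sub>P\<close> of power
  decay. The doubling constant is fixed here so that later constants can be chosen in terms of
  it.\<close>

locale power_decay_families =
  fixes d :: "'a \<Rightarrow> 'a \<Rightarrow> real" and K M \<gamma> \<epsilon> \<kappa> C\<^sub>D :: real
    and \<mu> :: "'a measure" and \<Omega> :: "'a set"
    and S :: "'a set \<Rightarrow> ('a \<Rightarrow> real) \<Rightarrow> ennreal"
    and \<K> :: "('a \<Rightarrow> real) \<Rightarrow> ('a set \<times> ('a \<Rightarrow> real)) set"
  assumes qd: "quasi_distance d K"
    and sets_qball: "r > 0 \<Longrightarrow> qball d x r \<in> sets \<mu>"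
    and qball_finite: "r > 0 \<Longrightarrow> emeasure \<mu> (qball d x r) < \<infinity>"
    and qball_pos: "r > 0 \<Longrightarrow> 0 < emeasure \<mu> (qball d x r)"
    and C\<^sub>D: "C\<^sub>D > 0"
    and doubling: "r > 0 \<Longrightarrow> emeasure \<mu> (qball d x (2 * r)) \<le> ennreal C\<^sub>D * emeasure \<mu> (qball d x r)"
    and ball_fun: "ball_functional d \<mu> \<Omega> S"
    and families: "admissible_families d \<mu> \<Omega> S \<K>"
    and decay: "f \<in> S_finite_funs d \<mu> \<Omega> S \<Longrightarrow> power_decay d \<mu> S \<K> f M \<gamma> \<epsilon> \<kappa>"
    and params: "1 < M" "0 < \<gamma>" "\<gamma> < 1" "0 < \<epsilon>" "1 < \<kappa>"
begin

section \<open>The closure properties in usable form\<close>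

lemma K_ge_1: "1 \<le> K"
  using qd by (simp add: quasi_distance_def)

lemma family_member:
  assumes "f \<in> S_finite_funs d \<mu> \<Omega> S" and "(A, u) \<in> \<K> f"
  shows "A \<subseteq> \<Omega>" and "u \<in> measurable_funs \<mu> A" and "x \<in> A \<Longrightarrow> 0 \<le> u x"
  using families[unfolded admissible_families_def, THEN conjunct1,
      THEN bspec, OF assms(1), THEN bspec, OF assms(2)] by simp_all

lemma family_scale:
  assumes f: "f \<in> S_finite_funs d \<mu> \<Omega> S" and u: "(A, u) \<in> \<K> f" and "0 \<le> l"
  shows "(A, \<lambda>x\<in>A. l * u x) \<in> \<K> (\<lambda>x\<in>\<Omega>. l * f x)"
  using families[unfolded admissible_families_def, THEN conjunct2, THEN conjunct1,
      THEN bspec, OF f, THEN bspec, OF u] assms(3) by simp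

lemma family_flip:
  assumes f: "f \<in> S_finite_funs d \<mu> \<Omega> S" and u: "(A, u) \<in> \<K> f" and "0 \<le> l" "0 \<le> t"
    and "A' \<subseteq> A" "qopen d A'" and "\<And>x. x \<in> A' \<Longrightarrow> 0 \<le> t - l * u x"
  shows "(A', \<lambda>x\<in>A'. t - l * u x) \<in> \<K> (\<lambda>x\<in>\<Omega>. - l * f x)"
  using families[unfolded admissible_families_def, THEN conjunct2, THEN conjunct2,
      THEN bspec, OF f, THEN bspec, OF u] assms(3-7) by simp

lemma S_scale:
  assumes "f \<in> S_finite_funs d \<mu> \<Omega> S" and "B \<in> balls_in d \<Omega>"
  shows "S B (\<lambda>x\<in>\<Omega>. c * f x) = ennreal \<bar>c\<bar> * S B f"
proof -
  have "f \<in> measurable_funs \<mu> \<Omega>" using assms(1) by (simp add: S_finite_funs_def)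
  then show ?thesis
    using ball_fun[unfolded ball_functional_def, THEN conjunct2] assms(2) by auto
qed

lemma S_mono:
  assumes "f \<in> S_finite_funs d \<mu> \<Omega> S" and "B \<in> balls_in d \<Omega>" and "B' \<in> balls_in d \<Omega>"
    and "B' \<subseteq> B"
  shows "S B' f \<le> S B f"
  using ball_fun assms unfolding ball_functional_def S_finite_funs_def by blast

lemma scale_in_S_finite_funs:
  assumes f: "f \<in> S_finite_funs d \<mu> \<Omega> S"
  shows "(\<lambda>x\<in>\<Omega>. c * f x) \<in> S_finite_funs d \<mu> \<Omega> S"
proof -
  have "f \<in> borel_measurable (restrict_space \<mu> \<Omega>)"
    using f by (simp add: S_finite_funs_def measurable_funs_def)
  then have "(\<lambda>x. c * f x) \<in> borel_measurable (restrict_space \<mu> \<Omega>)" by simp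
  then have "(\<lambda>x\<in>\<Omega>. c * f x) \<in> borel_measurable (restrict_space \<mu> \<Omega>)"
    by (subst measurable_cong[where g = "\<lambda>x. c * f x"]) (auto simp: space_restrict_space)
  moreover have "S B (\<lambda>x\<in>\<Omega>. c * f x) < \<infinity>" if "B \<in> balls_in d \<Omega>" for B
    unfolding S_scale[OF f that] using f that
    by (auto simp: S_finite_funs_def ennreal_mult_less_top)
  ultimately show ?thesis
    by (simp add: S_finite_funs_def measurable_funs_def)
qed

lemma qball_in_balls_in: "r > 0 \<Longrightarrow> qball d x r \<subseteq> \<Omega> \<Longrightarrow> qball d x r \<in> balls_in d \<Omega>"
  unfolding balls_in_def using centre_in_qball[OF qd, of r x] by blast

section \<open>Measure estimates for level sets\<close>

lemma decay_at_point:
  assumes f: "f \<in> S_finite_funs d \<mu> \<Omega> S" and u: "(A, u) \<in> \<K> f" and R: "R > 0"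
    and ball: "qball d x (\<kappa> * R) \<subseteq> A"
    and inf: "(INF y\<in>qball d x R. u y) \<le> 1"
    and S: "S (qball d x (\<kappa> * R)) f < ennreal \<epsilon>"
  shows "emeasure \<mu> {y \<in> qball d x (R / 2). M ^ k < u y}
           \<le> ennreal (\<gamma> ^ k) * emeasure \<mu> (qball d x (R / 2))"
proof -
  have "\<forall>R>0. \<forall>(A, u)\<in>\<K> f.
      qball d x (\<kappa> * R) \<subseteq> A \<and> (INF y\<in>qball d x R. u y) \<le> 1 \<and>
      S (qball d x (\<kappa> * R)) f < ennreal \<epsilon> \<longrightarrow>
      (\<forall>k. emeasure \<mu> {y \<in> qball d x (R / 2). M ^ k < u y}
        \<le> ennreal (\<gamma> ^ k) * emeasure \<mu> (qball d x (R / 2)))"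
    using decay[OF f] by (simp add: power_decay_def)
  from this[rule_format, OF R u] show ?thesis using ball inf S by simp
qed

text \<open>The infimum is taken in the reals, where it is meaningful only for sets bounded below;
  nonnegativity of the family members provides this.\<close>

lemma INF_le_of_member:
  assumes "f \<in> S_finite_funs d \<mu> \<Omega> S" and "(A, u) \<in> \<K> f" and "B \<subseteq> A" and "x \<in> B" and "u x \<le> c"
  shows "(INF y\<in>B. u y) \<le> c"
proof (rule cINF_lower2)
  show "bdd_below (u ` B)"
    using family_member(3)[OF assms(1,2)] assms(3) by (intro bdd_belowI[of _ 0]) auto
qed (use assms in auto)

text \<open>The balls in the hypotheses are larger than \<open>B\<^bsub>\<kappa>r\<^esub>\<close> by the factor \<open>2 K\<close> so that an open set
  fits in between: the family is closed under \<open>\<tau> - \<lambda> u\<close> on open subdomains, and balls need not be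
  open.\<close>

lemma measure_low_values:
  assumes f: "f \<in> S_finite_funs d \<mu> \<Omega> S" and u: "(A, u) \<in> \<K> f" and r: "r > 0"
    and ball: "qball d x (2 * K * \<kappa> * r) \<subseteq> A"
    and t: "t > 0" and nu: "\<nu> > 1" "M ^ k < (\<nu> - 1/2) / (\<nu> - 1)"
    and ux: "t \<le> u x" and le: "\<And>y. y \<in> qball d x (2 * K * \<kappa> * r) \<Longrightarrow> u y \<le> \<nu> * t"
    and S: "S (qball d x (\<kappa> * r)) f < ennreal (\<epsilon> * ((\<nu> - 1) * t))"
  shows "emeasure \<mu> {y \<in> qball d x (r / 2). u y \<le> t / 2}
           \<le> ennreal (\<gamma> ^ k) * emeasure \<mu> (qball d x (r / 2))"
proof -
  \<comment> \<open>Dividing \<open>\<nu> * t - u\<close> by this number makes it at most 1 at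
    \<open>x\<close>, where \<open>u x\<close> is at least \<open>t\<close>. This yields the infimum
    condition of power decay.\<close>
  define D where "D = (\<nu> - 1) * t"
  have D: "D > 0" using nu t by (simp add: D_def)
  define l where "l = 1 / D"
  have l: "l > 0" using D by (simp add: l_def)
  \<comment> \<open>An open set between the balls of radius \<open>\<kappa> * r\<close> and
    \<open>2 * K * \<kappa> * r\<close>: every point of the former is the centre of a ball of radius
    \<open>\<kappa> * r\<close> inside the latter.\<close>
  define A' where "A' = {y. \<exists>s>0. qball d y s \<subseteq> qball d x (2 * K * \<kappa> * r)}"
  define w where "w = (\<lambda>y\<in>A'. \<nu> * t / D - l * u y)"
  define g where "g = (\<lambda>y\<in>\<Omega>. - l * f y)"
  have A'_ball: "A' \<subseteq> qball d x (2 * K * \<kappa> * r)"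
    unfolding A'_def using centre_in_qball[OF qd] by blast
  have ball_A': "qball d x (\<kappa> * r) \<subseteq> A'"
  proof
    fix y assume "y \<in> qball d x (\<kappa> * r)"
    then have "qball d y (\<kappa> * r) \<subseteq> qball d x (2 * K * \<kappa> * r)"
      by (intro qball_subset_qball[OF qd, of x y "\<kappa> * r"]) (auto simp: qball_def algebra_simps)
    then show "y \<in> A'" unfolding A'_def using params r by (intro CollectI exI[of _ "\<kappa> * r"]) simp
  qed
  have r_kr: "r \<le> \<kappa> * r" using params r by simp
  have half_A': "qball d x (r / 2) \<subseteq> A'"
    using ball_A' qball_mono[of "r / 2" "\<kappa> * r" d x] r_kr r by fastforce
  have x_ball: "x \<in> qball d x r" by (rule centre_in_qball[OF qd r])
  have ball_r: "qball d x r \<subseteq> A'" using ball_A' qball_mono[OF r_kr, of d x] by blast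
  have g_fin: "g \<in> S_finite_funs d \<mu> \<Omega> S"
    unfolding g_def by (rule scale_in_S_finite_funs[OF f])
  have nonneg: "0 \<le> \<nu> * t / D - l * u y" if "y \<in> A'" for y
    using le[of y] that A'_ball D by (auto simp: l_def field_simps)
  have w: "(A', w) \<in> \<K> g"
    unfolding w_def g_def
  proof (rule family_flip[OF f u])
    show "A' \<subseteq> A" using A'_ball ball by blast
    show "qopen d A'" unfolding A'_def by (rule qopen_interior[OF qd])
  qed (use l D t nu nonneg in auto)
  have "w x \<le> 1"
  proof -
    have "w x = (\<nu> * t - u x) / D"
      using x_ball ball_r by (auto simp: w_def l_def diff_divide_distrib)
    also have "\<dots> \<le> 1" using ux D by (simp add: D_def algebra_simps)
    finally show ?thesis .
  qed
  then have inf: "(INF y\<in>qball d x r. w y) \<le> 1"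
    by (rule INF_le_of_member[OF g_fin w ball_r x_ball])
  have B: "qball d x (\<kappa> * r) \<in> balls_in d \<Omega>"
    using params r ball_A' A'_ball ball family_member(1)[OF f u] by (intro qball_in_balls_in) auto
  have "S (qball d x (\<kappa> * r)) g = ennreal l * S (qball d x (\<kappa> * r)) f"
    unfolding g_def S_scale[OF f B] using l by simp
  also have "\<dots> < ennreal l * ennreal (\<epsilon> * D)"
    using S l by (intro ennreal_mult_strict_left_mono) (auto simp: D_def)
  also have "\<dots> = ennreal \<epsilon>"
    using l D params by (simp add: ennreal_mult[symmetric] l_def)
  finally have Sg: "S (qball d x (\<kappa> * r)) g < ennreal \<epsilon>" .
  have "emeasure \<mu> {y \<in> qball d x (r / 2). u y \<le> t / 2}
      \<le> emeasure \<mu> {y \<in> qball d x (r / 2). w y \<in> {M ^ k<..}}"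
  proof (rule emeasure_mono)
    show "{y \<in> qball d x (r / 2). w y \<in> {M ^ k<..}} \<in> sets \<mu>"
      using r half_A' by (intro sets_Collect_measurable_funs[OF family_member(2)[OF g_fin w]]
          sets_qball) auto
    show "{y \<in> qball d x (r / 2). u y \<le> t / 2} \<subseteq> {y \<in> qball d x (r / 2). w y \<in> {M ^ k<..}}"
    proof
      fix y assume "y \<in> {y \<in> qball d x (r / 2). u y \<le> t / 2}"
      then have y: "y \<in> qball d x (r / 2)" "u y \<le> t / 2" by auto
      \<comment> \<open>Where \<open>u\<close> is at most \<open>t / 2\<close>, the reflected
        function \<open>w\<close> is at least this quotient, which exceeds
        \<open>M ^ k\<close>.\<close>
      have "(\<nu> - 1/2) / (\<nu> - 1) = (\<nu> * t - t / 2) / D"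
        using nu t by (simp add: D_def field_simps)
      also have "\<dots> \<le> (\<nu> * t - u y) / D"
        using y D by (intro divide_right_mono) auto
      also have "\<dots> = w y"
        using y half_A' by (auto simp: w_def l_def diff_divide_distrib)
      finally show "y \<in> {y \<in> qball d x (r / 2). w y \<in> {M ^ k<..}}" using nu y by simp
    qed
  qed
  also have "\<dots> \<le> ennreal (\<gamma> ^ k) * emeasure \<mu> (qball d x (r / 2))"
    using decay_at_point[OF g_fin w r ball_A' inf Sg, of k] by simp
  finally show ?thesis .
qed

text \<open>The two level set estimates live at different scales. The one for low values is local to
  the ball of radius \<open>r\<close>; the one for high values comes from a ball comparable with
  \<open>R\<close> and reaches the small ball through \<open>p\<close> doublings. A smaller
  \<open>r\<close> thus needs a larger decay exponent \<open>m\<close>, that is, a larger height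
  \<open>t\<close>.\<close>

lemma growth_step:
  assumes f: "f \<in> S_finite_funs d \<mu> \<Omega> S" and u: "(A, u) \<in> \<K> f" and R: "R > 0" and r: "r > 0"
    and ball: "qball d x\<^sub>0 (4 * K\<^sup>2 * \<kappa> * R) \<subseteq> A"
    and inf: "(INF y\<in>qball d x\<^sub>0 R. u y) \<le> 1"
    and S: "S (qball d x\<^sub>0 (4 * K\<^sup>2 * \<kappa> * R)) f < ennreal \<epsilon>"
    and x: "qball d x (2 * K * \<kappa> * r) \<subseteq> qball d x\<^sub>0 (2 * K * R)"
    and nu: "\<nu> > 1" "M ^ k < (\<nu> - 1/2) / (\<nu> - 1)" and k: "\<gamma> ^ k < 1/2"
    and t: "2 * M ^ m \<le> t" "1 \<le> (\<nu> - 1) * t" and ux: "t \<le> u x"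
    and p: "8 * K ^ 3 * R \<le> 2 ^ p * r" and m: "\<gamma> ^ m * C\<^sub>D ^ p \<le> 1/2"
  shows "\<exists>y\<in>qball d x (2 * K * \<kappa> * r). \<nu> * t \<le> u y"
proof (rule ccontr)
  assume "\<not> ?thesis"
  then have le: "u y \<le> \<nu> * t" if "y \<in> qball d x (2 * K * \<kappa> * r)" for y
    using that by force
  note K = K_ge_1
  have K2: "K \<le> K\<^sup>2" using K by (simp add: power2_eq_square)
  have K\<kappa>: "1 \<le> K * \<kappa>" using K params mult_mono[of 1 K 1 \<kappa>] by simp
  have Mm: "M ^ m > 0" using params by simp
  then have t0: "t > 0" using t by linarith
  define a where "a = 2 * K * \<kappa> * r"
  have r_a: "r \<le> a" using K\<kappa> r mult_right_mono[of 1 "2 * K * \<kappa>" r] by (simp add: a_def)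
  have \<kappa>r_a: "\<kappa> * r \<le> a"
    using K r params mult_right_mono[of 1 "2 * K" "\<kappa> * r"] by (simp add: a_def mult.assoc)
  have G_sub: "qball d x\<^sub>0 (2 * K * R) \<subseteq> qball d x\<^sub>0 (2 * K\<^sup>2 * R)"
    using K2 R by (intro qball_mono) auto
  have big_le: "2 * K\<^sup>2 * R \<le> 4 * K\<^sup>2 * \<kappa> * R"
  proof -
    have "2 * K\<^sup>2 * R * 1 \<le> 2 * K\<^sup>2 * R * (2 * \<kappa>)"
      using R params by (intro mult_left_mono) auto
    then show ?thesis by (simp add: algebra_simps)
  qed
  have H_A: "qball d x\<^sub>0 (2 * K\<^sup>2 * R) \<subseteq> A"
    using qball_mono[OF big_le, of d x\<^sub>0] ball by blast
  \<comment> \<open>Power decay at this radius is a statement about the ball of radius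
    \<open>2 * K\<^sup>2 * R\<close>, which contains the ball of radius \<open>2 * K * R\<close>
    where the chain runs, and it uses exactly the enlarged ball
    \<open>4 * K\<^sup>2 * \<kappa> * R\<close> of the hypotheses.\<close>
  define R' where "R' = 4 * K\<^sup>2 * R"
  have R': "R' > 0" "R' / 2 = 2 * K\<^sup>2 * R" "\<kappa> * R' = 4 * K\<^sup>2 * \<kappa> * R"
    using K R by (auto simp: R'_def)
  have R_R': "R \<le> R'"
  proof -
    have "1 * R \<le> (4 * K\<^sup>2) * R" using K K2 R by (intro mult_right_mono) linarith+
    then show ?thesis by (simp add: R'_def)
  qed
  have R'_A: "qball d x\<^sub>0 R' \<subseteq> A"
  proof -
    have "R' \<le> \<kappa> * R'" using R'(1) params(5) mult_right_mono[of 1 \<kappa> R'] by simp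
    then show ?thesis using qball_mono[of R' "\<kappa> * R'" d x\<^sub>0] ball R' by auto
  qed
  have "(INF y\<in>qball d x\<^sub>0 R'. u y) \<le> (INF y\<in>qball d x\<^sub>0 R. u y)"
  proof (rule cINF_superset_mono)
    show "qball d x\<^sub>0 R \<noteq> {}" using centre_in_qball[OF qd R] by blast
    show "bdd_below (u ` qball d x\<^sub>0 R')"
      using family_member(3)[OF f u] R'_A by (intro bdd_belowI[of _ 0]) auto
  qed (use qball_mono[OF R_R', of d x\<^sub>0] in auto)
  then have decay0: "emeasure \<mu> {y \<in> qball d x\<^sub>0 (2 * K\<^sup>2 * R). M ^ m < u y}
      \<le> ennreal (\<gamma> ^ m) * emeasure \<mu> (qball d x\<^sub>0 (2 * K\<^sup>2 * R))"
    using decay_at_point[OF f u R'(1), of x\<^sub>0 m] ball inf S R' by simp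
  have x_G: "x \<in> qball d x\<^sub>0 (2 * K * R)"
    using x centre_in_qball[OF qd, of a x] r_a r unfolding a_def by auto
  define B where "B = qball d x (r / 2)"
  have B_a: "B \<subseteq> qball d x a" unfolding B_def using r_a r by (intro qball_mono) auto
  then have B_H: "B \<subseteq> qball d x\<^sub>0 (2 * K\<^sup>2 * R)" using x G_sub unfolding a_def by blast
  have B_sets: "B \<in> sets \<mu>" unfolding B_def using r by (intro sets_qball) simp
  have x_A: "qball d x (2 * K * \<kappa> * r) \<subseteq> A" using x G_sub H_A by blast
  have "emeasure \<mu> (qball d x\<^sub>0 (2 * K\<^sup>2 * R)) \<le> emeasure \<mu> (qball d x (2 ^ p * (r / 2)))"
  proof (rule emeasure_mono)
    \<comment> \<open>Recentring at \<open>x\<close> costs at most the radius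
      \<open>4 * K ^ 3 * R\<close>; as the small ball has radius \<open>r / 2\<close>, this becomes
      the \<open>8 * K ^ 3\<close> of the hypothesis on \<open>p\<close>.\<close>
    show "qball d x\<^sub>0 (2 * K\<^sup>2 * R) \<subseteq> qball d x (2 ^ p * (r / 2))"
    proof (rule qball_subset_qball[OF qd])
      show "d x x\<^sub>0 \<le> 2 * K * R"
        using x_G qd unfolding qball_def quasi_distance_def by (metis mem_Collect_eq less_imp_le)
      have "K * (2 * K * R) \<le> K * (2 * K\<^sup>2 * R)"
        using K2 K R by (intro mult_left_mono) auto
      then show "K * (2 * K * R + 2 * K\<^sup>2 * R) \<le> 2 ^ p * (r / 2)"
        using p by (simp add: algebra_simps power2_eq_square power3_eq_cube)
    qed
    show "qball d x (2 ^ p * (r / 2)) \<in> sets \<mu>" using r by (intro sets_qball) simp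
  qed
  also have "\<dots> \<le> ennreal (C\<^sub>D ^ p) * emeasure \<mu> B"
    unfolding B_def using doubling C\<^sub>D r by (intro emeasure_qball_power) auto
  finally have H_B: "emeasure \<mu> (qball d x\<^sub>0 (2 * K\<^sup>2 * R)) \<le> ennreal (C\<^sub>D ^ p) * emeasure \<mu> B" .
  have high: "emeasure \<mu> {y \<in> B. t / 2 < u y} \<le> ennreal (1/2) * emeasure \<mu> B"
  proof -
    have "emeasure \<mu> {y \<in> B. t / 2 < u y}
        \<le> emeasure \<mu> {y \<in> qball d x\<^sub>0 (2 * K\<^sup>2 * R). u y \<in> {M ^ m<..}}"
    proof (rule emeasure_mono)
      show "{y \<in> qball d x\<^sub>0 (2 * K\<^sup>2 * R). u y \<in> {M ^ m<..}} \<in> sets \<mu>"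
        using H_A K R by (intro sets_Collect_measurable_funs[OF family_member(2)[OF f u]]
            sets_qball) auto
    qed (use B_H t in auto)
    also have "\<dots> \<le> ennreal (\<gamma> ^ m) * (ennreal (C\<^sub>D ^ p) * emeasure \<mu> B)"
      using order_trans[OF decay0 mult_left_mono[OF H_B zero_le]] by simp
    also have "\<dots> = ennreal (\<gamma> ^ m * C\<^sub>D ^ p) * emeasure \<mu> B"
      using params C\<^sub>D by (simp add: ennreal_mult mult.assoc)
    also have "\<dots> \<le> ennreal (1/2) * emeasure \<mu> B"
      using m by (intro mult_right_mono ennreal_leI) auto
    finally show ?thesis .
  qed
  have low: "emeasure \<mu> {y \<in> B. u y \<le> t / 2} \<le> ennreal (\<gamma> ^ k) * emeasure \<mu> B"
    unfolding B_def
  proof (rule measure_low_values[OF f u r x_A t0 nu ux le])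
    have "qball d x (\<kappa> * r) \<subseteq> qball d x\<^sub>0 (4 * K\<^sup>2 * \<kappa> * R)"
      using qball_mono[OF \<kappa>r_a, of d x] x G_sub qball_mono[OF big_le, of d x\<^sub>0]
      unfolding a_def by blast
    then have "S (qball d x (\<kappa> * r)) f \<le> S (qball d x\<^sub>0 (4 * K\<^sup>2 * \<kappa> * R)) f"
      using ball family_member(1)[OF f u] K R r params
      by (intro S_mono[OF f] qball_in_balls_in) auto
    also have "\<dots> < ennreal \<epsilon>" by (rule S)
    also have "\<dots> \<le> ennreal (\<epsilon> * ((\<nu> - 1) * t))"
      using t params by (intro ennreal_leI) simp
    finally show "S (qball d x (\<kappa> * r)) f < ennreal (\<epsilon> * ((\<nu> - 1) * t))" .
  qed
  have pos: "0 < emeasure \<mu> B" and fin: "emeasure \<mu> B < \<infinity>"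
    unfolding B_def using r qball_pos qball_finite by auto
  have level_sets: "{y \<in> B. u y \<in> Y} \<in> sets \<mu>" if "Y \<in> sets borel" for Y
    using sets_Collect_measurable_funs[OF family_member(2)[OF f u] B_sets _ that] B_H H_A by blast
  have "{y \<in> B. u y \<in> {..t / 2}} \<union> {y \<in> B. u y \<in> {t / 2<..}} = B" by auto
  then have "emeasure \<mu> B \<le> emeasure \<mu> {y \<in> B. u y \<in> {..t / 2}} + emeasure \<mu> {y \<in> B. u y \<in> {t / 2<..}}"
    using emeasure_subadditive[OF level_sets[of "{..t / 2}"] level_sets[of "{t / 2<..}"]] by simp
  also have "\<dots> \<le> ennreal (\<gamma> ^ k) * emeasure \<mu> B + ennreal (1/2) * emeasure \<mu> B"
    using low high by (intro add_mono) auto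
  also have "\<dots> = ennreal (\<gamma> ^ k + 1/2) * emeasure \<mu> B"
    using params by (subst ennreal_plus) (auto simp: distrib_right)
  \<comment> \<open>Strictness requires the measure of \<open>B\<close> to be both positive and
    finite.\<close>
  also have "\<dots> < ennreal 1 * emeasure \<mu> B"
  proof -
    obtain b where b: "emeasure \<mu> B = ennreal b" "b \<ge> 0"
      using fin by (cases "emeasure \<mu> B") auto
    have "b > 0" using pos b by simp
    then show ?thesis
      unfolding b(1) using k params b(2)
      by (subst (1 2) ennreal_mult[symmetric]) (auto simp: ennreal_less_iff)
  qed
  finally show False by simp
qed

section \<open>The choice of constants and the bound under normalization\<close>

text \<open>\<open>T\<close> is structural because all constants are fixed before \<open>f\<close>,
  \<open>u\<close> and the ball. They are chosen in the order \<open>k\<close>,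
  \<open>\<nu>\<close>, \<open>P\<close>, \<open>J\<close>, \<open>L\<close>, \<open>q\<close>,
  \<open>p\<close>, \<open>m\<close>, \<open>T\<close>, each from the parameters and earlier
  choices.\<close>

lemma normalized_bound:
  "\<exists>T>0. \<forall>f\<in>S_finite_funs d \<mu> \<Omega> S. \<forall>x\<^sub>0. \<forall>R>0. \<forall>A u. (A, u) \<in> \<K> f \<longrightarrow>
     qball d x\<^sub>0 (4 * K\<^sup>2 * \<kappa> * R) \<subseteq> A \<longrightarrow>
     (INF y\<in>qball d x\<^sub>0 R. u y) \<le> 1 \<longrightarrow>
     S (qball d x\<^sub>0 (4 * K\<^sup>2 * \<kappa> * R)) f < ennreal \<epsilon> \<longrightarrow>
     (\<exists>b. \<forall>y\<in>qball d x\<^sub>0 (2 * K * R). u y \<le> b) \<longrightarrow>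
     (\<forall>x\<in>qball d x\<^sub>0 R. u x \<le> T)"
proof -
  note K = K_ge_1
  have small: "\<exists>n. \<gamma> ^ n * c < e" if "c > 0" "e > 0" for c e
  proof -
    have "0 < e / c" using that by simp
    then obtain n where "\<gamma> ^ n < e / c"
      using real_arch_pow_inv[OF _ params(3)] by blast
    then show ?thesis using that by (auto simp: field_simps)
  qed
  have two_pow: "\<exists>n. c \<le> 2 ^ n" for c :: real
    using real_arch_pow[of 2 c] by (auto intro: less_imp_le)
  obtain k where k: "\<gamma> ^ k < 1/2" using small[of 1 "1/2"] by auto
  have Mk: "M ^ k > 0" using params by simp
  \<comment> \<open>With this value the quotient \<open>(\<nu> - 1/2) / (\<nu> - 1)\<close> equals
    \<open>M ^ k + 1\<close>.\<close>
  define \<nu> where "\<nu> = 1 + 1 / (2 * M ^ k)"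
  have nu: "\<nu> > 1" "M ^ k < (\<nu> - 1/2) / (\<nu> - 1)"
    using Mk params(1) by (simp_all add: \<nu>_def field_simps)
  \<comment> \<open>Radii shrink by \<open>2 ^ P\<close> per round, which costs \<open>P\<close>
    more doublings; \<open>J\<close> more powers of decay compensate for them. The successor in
    \<open>J\<close> guarantees \<open>H > 1\<close>.\<close>
  obtain P where P: "2 * K \<le> 2 ^ P" using two_pow by blast
  obtain J0 where J0: "\<gamma> ^ J0 * C\<^sub>D ^ P < 1" using small[of "C\<^sub>D ^ P" 1] C\<^sub>D by auto
  define J where "J = Suc J0"
  have J: "\<gamma> ^ J * C\<^sub>D ^ P \<le> 1"
  proof -
    have "\<gamma> * (\<gamma> ^ J0 * C\<^sub>D ^ P) \<le> 1 * 1"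
      using params C\<^sub>D J0 by (intro mult_mono) auto
    then show ?thesis by (simp add: J_def)
  qed
  define H where "H = M ^ J"
  have H1: "1 < H" using params by (simp add: H_def J_def one_less_power del: power_Suc)
  obtain L where L: "H \<le> \<nu> ^ L" using real_arch_pow[OF nu(1), of H] less_imp_le by blast
  \<comment> \<open>The first radius \<open>R / 2 ^ q\<close> is so small that the whole chain stays
    within \<open>R\<close> of its start. Then \<open>p\<close> counts the doublings back up to the
    large ball, and \<open>m\<close> compensates for them.\<close>
  obtain q where q: "2 * K * ((2 * K) ^ L * (2 * K * \<kappa>)) \<le> 2 ^ q" using two_pow by blast
  obtain p where p: "8 * K ^ 3 * 2 ^ q \<le> 2 ^ p" using two_pow by blast
  obtain m where m: "\<gamma> ^ m * C\<^sub>D ^ p < 1/2" using small[of "C\<^sub>D ^ p" "1/2"] C\<^sub>D by auto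
  \<comment> \<open>The first summand gives the decay threshold; the second gives
    \<open>1 \<le> (\<nu> - 1) * T\<close>, because
    \<open>(\<nu> - 1) * (2 * M ^ k) = 1\<close>.\<close>
  define T where "T = 2 * M ^ m + 2 * M ^ k"
  have T: "T > 0" "2 * M ^ m \<le> T" "1 \<le> (\<nu> - 1) * T"
    using params Mk by (simp_all add: T_def \<nu>_def field_simps add_pos_pos)
  have "u x \<le> T"
    if f: "f \<in> S_finite_funs d \<mu> \<Omega> S" and R: "R > 0" and u: "(A, u) \<in> \<K> f"
      and ball: "qball d x\<^sub>0 (4 * K\<^sup>2 * \<kappa> * R) \<subseteq> A"
      and inf: "(INF y\<in>qball d x\<^sub>0 R. u y) \<le> 1"
      and S: "S (qball d x\<^sub>0 (4 * K\<^sup>2 * \<kappa> * R)) f < ennreal \<epsilon>"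
      and bdd: "\<exists>b. \<forall>y\<in>qball d x\<^sub>0 (2 * K * R). u y \<le> b"
      and x: "x \<in> qball d x\<^sub>0 R" for f x\<^sub>0 R A u x
  proof (rule ccontr)
    assume "\<not> u x \<le> T"
    then have ux: "T \<le> u x" by simp
    define r where "r = (\<lambda>j. R / 2 ^ q / (2 ^ P) ^ j)"
    define a where "a = 2 * K * \<kappa> * (R / 2 ^ q)"
    have r: "r j > 0" for j using R by (simp add: r_def)
    have a_r: "a / (2 ^ P) ^ j = 2 * K * \<kappa> * r j" for j by (simp add: a_def r_def)
    have "\<not> (\<exists>b. \<forall>y\<in>qball d x\<^sub>0 (2 * K * R). u y \<le> b)"
    proof (rule unbounded_of_growth[OF qd _ T(1) nu(1) P H1 L])
      show "a > 0" using K R params by (simp add: a_def)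
      show "T \<le> u x" by (rule ux)
      show "qball d x (2 * K * ((2 * K) ^ L * a)) \<subseteq> qball d x\<^sub>0 (2 * K * R)"
      proof (rule qball_subset_qball[OF qd, of x\<^sub>0 x R])
        show "d x\<^sub>0 x \<le> R" using x by (simp add: qball_def)
        have "2 * K * ((2 * K) ^ L * (2 * K * \<kappa>)) * (R / 2 ^ q) \<le> 2 ^ q * (R / 2 ^ q)"
          using q R by (intro mult_right_mono) auto
        then have "2 * K * ((2 * K) ^ L * a) \<le> R" by (simp add: a_def mult.assoc)
        then have "K * (R + 2 * K * ((2 * K) ^ L * a)) \<le> K * (R + R)"
          using K by (intro mult_left_mono) auto
        then show "K * (R + 2 * K * ((2 * K) ^ L * a)) \<le> 2 * K * R" by simp
      qed
    next
      fix j y s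
      assume y: "qball d y (a / (2 ^ P) ^ j) \<subseteq> qball d x\<^sub>0 (2 * K * R)"
        and s: "T * H ^ j \<le> s" "s \<le> u y"
      have Hj: "1 \<le> H ^ j" using H1 by (simp add: one_le_power)
      show "\<exists>z\<in>qball d y (a / (2 ^ P) ^ j). \<nu> * s \<le> u z"
        unfolding a_r
      \<comment> \<open>Round \<open>j\<close> uses the exponents \<open>m + J * j\<close> and
        \<open>p + P * j\<close>: the height has grown by \<open>M ^ (J * j)\<close> while the
        radius has shrunk by \<open>2 ^ (P * j)\<close>.\<close>
      proof (rule growth_step[OF f u R r ball inf S _ nu k _ _ s(2)])
        show "qball d y (2 * K * \<kappa> * r j) \<subseteq> qball d x\<^sub>0 (2 * K * R)"
          using y by (simp add: a_r)
        have "2 * M ^ m * H ^ j \<le> T * H ^ j"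
          using T Hj by (intro mult_right_mono) auto
        then show "2 * M ^ (m + J * j) \<le> s"
          using s by (simp add: H_def power_add power_mult)
        have "T * 1 \<le> T * H ^ j" using T Hj by (intro mult_left_mono) auto
        then have "(\<nu> - 1) * T \<le> (\<nu> - 1) * s" using s nu by (intro mult_left_mono) auto
        then show "1 \<le> (\<nu> - 1) * s" using T by linarith
        have "8 * K ^ 3 * 2 ^ q * (R / 2 ^ q) \<le> 2 ^ p * (R / 2 ^ q)"
          using p R by (intro mult_right_mono) auto
        then show "8 * K ^ 3 * R \<le> 2 ^ (p + P * j) * r j"
          by (simp add: r_def power_add power_mult)
        have "(\<gamma> ^ m * C\<^sub>D ^ p) * (\<gamma> ^ J * C\<^sub>D ^ P) ^ j \<le> 1/2 * 1"
          using m J params C\<^sub>D by (intro mult_mono power_le_one) auto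
        then show "\<gamma> ^ (m + J * j) * C\<^sub>D ^ (p + P * j) \<le> 1/2"
          by (simp add: power_add power_mult power_mult_distrib algebra_simps)
      qed
    qed
    then show False using bdd by blast
  qed
  then show ?thesis using T(1) by blast
qed

section \<open>Removal of the normalization\<close>

text \<open>The normalized bound is applied to a multiple of \<open>u\<close>. The infimum need not
  be attained, so an arbitrary point \<open>z\<close> replaces it and the infimum over
  \<open>z\<close> is taken last.\<close>

lemma harnack:
  "\<exists>C>0. \<forall>f\<in>S_finite_funs d \<mu> \<Omega> S. \<forall>x\<^sub>0. \<forall>R>0. \<forall>A u. (A, u) \<in> \<K> f \<longrightarrow>
     qball d x\<^sub>0 (4 * K\<^sup>2 * \<kappa> * R) \<subseteq> A \<longrightarrow>
     (\<exists>b. \<forall>y\<in>qball d x\<^sub>0 (2 * K * R). u y \<le> b) \<longrightarrow>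
     (SUP x\<in>qball d x\<^sub>0 R. ennreal (u x))
       \<le> ennreal C * ((INF x\<in>qball d x\<^sub>0 R. ennreal (u x)) + S (qball d x\<^sub>0 (4 * K\<^sup>2 * \<kappa> * R)) f)"
proof -
  note K = K_ge_1
  obtain T where T: "T > 0"
    and bound: "\<And>f x\<^sub>0 R A u x. f \<in> S_finite_funs d \<mu> \<Omega> S \<Longrightarrow> R > 0 \<Longrightarrow> (A, u) \<in> \<K> f \<Longrightarrow>
     qball d x\<^sub>0 (4 * K\<^sup>2 * \<kappa> * R) \<subseteq> A \<Longrightarrow>
     (INF y\<in>qball d x\<^sub>0 R. u y) \<le> 1 \<Longrightarrow>
     S (qball d x\<^sub>0 (4 * K\<^sup>2 * \<kappa> * R)) f < ennreal \<epsilon> \<Longrightarrow>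
     \<exists>b. \<forall>y\<in>qball d x\<^sub>0 (2 * K * R). u y \<le> b \<Longrightarrow>
     x \<in> qball d x\<^sub>0 R \<Longrightarrow> u x \<le> T"
    using normalized_bound by metis
  define C where "C = T * (1 + 2 / \<epsilon>)"
  have C: "C > 0" using T params by (simp add: C_def add_pos_pos)
  have "(SUP x\<in>qball d x\<^sub>0 R. ennreal (u x))
       \<le> ennreal C * ((INF x\<in>qball d x\<^sub>0 R. ennreal (u x)) + S (qball d x\<^sub>0 (4 * K\<^sup>2 * \<kappa> * R)) f)"
    if f: "f \<in> S_finite_funs d \<mu> \<Omega> S" and R: "R > 0" and u: "(A, u) \<in> \<K> f"
      and ball: "qball d x\<^sub>0 (4 * K\<^sup>2 * \<kappa> * R) \<subseteq> A"
      and bdd: "\<exists>b. \<forall>y\<in>qball d x\<^sub>0 (2 * K * R). u y \<le> b" for f x\<^sub>0 R A u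
  proof -
    define B where "B = qball d x\<^sub>0 (4 * K\<^sup>2 * \<kappa> * R)"
    have B: "B \<in> balls_in d \<Omega>"
      unfolding B_def using K R params ball family_member(1)[OF f u]
      by (intro qball_in_balls_in) auto
    then have "S B f < \<infinity>" using f by (simp add: S_finite_funs_def)
    then obtain s where s: "S B f = ennreal s" "s \<ge> 0" by (cases "S B f") auto
    have "R * 1 \<le> R * (4 * K\<^sup>2 * \<kappa>)"
    proof (intro mult_left_mono)
      have "1 * 1 \<le> K\<^sup>2 * \<kappa>" using K params by (intro mult_mono) auto
      then show "1 \<le> 4 * K\<^sup>2 * \<kappa>" by simp
    qed (use R in simp)
    then have R_A: "qball d x\<^sub>0 R \<subseteq> A"
      using qball_mono[of R "4 * K\<^sup>2 * \<kappa> * R" d x\<^sub>0] ball by (auto simp: algebra_simps)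
    have key: "u x \<le> C * (u z + s)"
      if x: "x \<in> qball d x\<^sub>0 R" and z: "z \<in> qball d x\<^sub>0 R" for x z
    proof -
      have uz: "u z \<ge> 0" using family_member(3)[OF f u] R_A z by blast
      have "u x \<le> C * (u z + s) + e" if e: "e > 0" for e
      proof -
        \<comment> \<open>Division by \<open>D\<close> brings the value at \<open>z\<close> down to
          at most 1 and \<open>S\<close> below \<open>\<epsilon>\<close>. The term
          \<open>e / T\<close> keeps \<open>D\<close> positive when \<open>u z\<close> and
          \<open>s\<close> vanish, and contributes exactly \<open>e\<close> after multiplication by
          \<open>T\<close>.\<close>
        define D where "D = u z + 2 / \<epsilon> * s + e / T"
        have s': "2 / \<epsilon> * s \<ge> 0" using s params by simp
        have D: "D > 0" unfolding D_def using uz s' e T by (simp add: add_nonneg_pos)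
        define g where "g = (\<lambda>y\<in>\<Omega>. 1 / D * f y)"
        define v where "v = (\<lambda>y\<in>A. 1 / D * u y)"
        have v: "(A, v) \<in> \<K> g"
          unfolding v_def g_def using D by (intro family_scale[OF f u]) simp
        have g: "g \<in> S_finite_funs d \<mu> \<Omega> S"
          unfolding g_def by (rule scale_in_S_finite_funs[OF f])
        have "v z \<le> 1"
          using z R_A D s' e T by (auto simp: v_def) (auto simp: D_def)
        then have inf: "(INF y\<in>qball d x\<^sub>0 R. v y) \<le> 1"
          by (rule INF_le_of_member[OF g v R_A z])
        have "S B g = ennreal (s / D)"
          unfolding g_def S_scale[OF f B] s(1) using D s(2)
          by (simp add: ennreal_mult[symmetric])
        moreover have "s / D < \<epsilon>"
        proof -
          have "\<epsilon> * D = \<epsilon> * u z + 2 * s + \<epsilon> * (e / T)"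
            using params by (simp add: D_def field_simps)
          moreover have "\<epsilon> * u z \<ge> 0" "\<epsilon> * (e / T) > 0" using params uz e T by auto
          ultimately have "s < \<epsilon> * D" using s(2) by linarith
          then show ?thesis using D by (simp add: field_simps)
        qed
        ultimately have Sg: "S B g < ennreal \<epsilon>"
          using params s(2) D by (simp add: ennreal_lessI)
        have "\<exists>b. \<forall>y\<in>qball d x\<^sub>0 (2 * K * R). v y \<le> b"
        proof -
          obtain b where b: "\<And>y. y \<in> qball d x\<^sub>0 (2 * K * R) \<Longrightarrow> u y \<le> b" using bdd by blast
          have "2 * K * R \<le> 4 * K\<^sup>2 * \<kappa> * R"
          proof -
            have "2 * K * R * 1 \<le> 2 * K * R * (2 * (K * \<kappa>))"
              using K R params mult_mono[of 1 K 1 \<kappa>] by (intro mult_left_mono) auto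
            then show ?thesis by (simp add: power2_eq_square algebra_simps)
          qed
          then have "qball d x\<^sub>0 (2 * K * R) \<subseteq> A"
            using qball_mono[of "2 * K * R" "4 * K\<^sup>2 * \<kappa> * R" d x\<^sub>0] ball by blast
          then have "\<forall>y\<in>qball d x\<^sub>0 (2 * K * R). v y \<le> b / D"
            using b D by (auto simp: v_def divide_right_mono)
          then show ?thesis ..
        qed
        then have "v x \<le> T"
          using bound[OF g R v ball inf _ _ x] Sg unfolding B_def by blast
        then have "u x \<le> T * D"
          using x R_A D by (auto simp: v_def field_simps)
        also have "\<dots> = T * (u z + 2 / \<epsilon> * s) + e"
          using T by (simp add: D_def field_simps)
        also have "\<dots> \<le> C * (u z + s) + e"
        proof -
          have "(1 + 2 / \<epsilon>) * (u z + s) = (u z + 2 / \<epsilon> * s) + (s + 2 / \<epsilon> * u z)"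
            by (simp only: distrib_left distrib_right)
          moreover have "0 \<le> s + 2 / \<epsilon> * u z" using uz s(2) params by simp
          ultimately have "u z + 2 / \<epsilon> * s \<le> (1 + 2 / \<epsilon>) * (u z + s)" by linarith
          then show ?thesis unfolding C_def using T by (simp add: mult.assoc)
        qed
        finally show ?thesis .
      qed
      then show ?thesis by (rule field_le_epsilon)
    qed
    show ?thesis
      unfolding B_def[symmetric]
    proof (rule SUP_least)
      fix x assume x: "x \<in> qball d x\<^sub>0 R"
      \<comment> \<open>If \<open>u x / C < s\<close>, the left side is 0, since
        \<open>ennreal\<close> truncates negative numbers. Moving \<open>s\<close> across avoids
        subtraction of extended reals.\<close>
      have "ennreal (u x / C - s) \<le> ennreal (u z)" if z: "z \<in> qball d x\<^sub>0 R" for z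
        using key[OF x z] C by (intro ennreal_leI) (simp add: field_simps)
      then have INF: "ennreal (u x / C - s) \<le> (INF z\<in>qball d x\<^sub>0 R. ennreal (u z))"
        by (rule INF_greatest)
      have "ennreal (u x) = ennreal (C * (u x / C))" using C by simp
      also have "\<dots> = ennreal C * ennreal (u x / C)" using C by (intro ennreal_mult') simp
      also have "ennreal (u x / C) \<le> ennreal (u x / C - s) + ennreal s"
        using s(2) by (cases "s \<le> u x / C") (auto simp: ennreal_plus[symmetric] ennreal_neg ennreal_leI
            simp del: ennreal_plus)
      also have "\<dots> \<le> (INF z\<in>qball d x\<^sub>0 R. ennreal (u z)) + S B f"
        unfolding s(1) using INF by (rule add_right_mono)
      finally show "ennreal (u x) \<le> ennreal C * ((INF x\<in>qball d x\<^sub>0 R. ennreal (u x)) + S B f)"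
        by (simp add: mult_left_mono)
    qed
  qed
  then show ?thesis using C by blast
qed

end

section \<open>From local boundedness to the Harnack inequality\<close>

theorem theorem2p8:
  fixes d :: "'a \<Rightarrow> 'a \<Rightarrow> real"
    and K M \<gamma> \<epsilon>\<^sub>P \<eta>\<^sub>P \<eta> :: real
    and \<mu> :: "'a measure"
    and \<Omega> :: "'a set"
    and S :: "'a set \<Rightarrow> ('a \<Rightarrow> real) \<Rightarrow> ennreal"
    and \<K> :: "('a \<Rightarrow> real) \<Rightarrow> ('a set \<times> ('a \<Rightarrow> real)) set"
  assumes "doubling_quasi_metric_space d K \<mu>"
    and "qopen d \<Omega>"
    and "ball_functional d \<mu> \<Omega> S"
    and "admissible_families d \<mu> \<Omega> S \<K>"
    and "\<forall>f\<in>S_finite_funs d \<mu> \<Omega> S. power_decay d \<mu> S \<K> f M \<gamma> \<epsilon>\<^sub>P \<eta>\<^sub>P"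
    and "\<eta> = 2 * K * (2 * K * \<eta>\<^sub>P + 1)"
  shows "\<exists>C::real. C > 0 \<and>
    (\<forall>f\<in>S_finite_funs d \<mu> \<Omega> S. \<forall>x\<^sub>0. \<forall>R>0. \<forall>(A, u)\<in>\<K> f.
       qball d x\<^sub>0 (\<eta> * R) \<subseteq> \<Omega> \<and> qball d x\<^sub>0 (\<eta> * R) \<subseteq> A \<and>
       (\<forall>x\<in>A. 0 \<le> u x) \<and> locally_bounded_on d (qball d x\<^sub>0 (\<eta> * R)) u \<longrightarrow>
       (SUP x\<in>qball d x\<^sub>0 R. ennreal (u x))
         \<le> ennreal C * ((INF x\<in>qball d x\<^sub>0 R. ennreal (u x)) + S (qball d x\<^sub>0 (\<eta> * R)) f))"
proof (cases "S_finite_funs d \<mu> \<Omega> S = {}")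
  \<comment> \<open>The parameter bounds are part of \<open>power_decay\<close>, so they are
    available only if some \<open>f\<close> exists; without one the claim is vacuous.\<close>
  case True
  then show ?thesis by (intro exI[of _ 1]) simp
next
  case False
  then have params: "1 < M" "0 < \<gamma>" "\<gamma> < 1" "0 < \<epsilon>\<^sub>P" "1 < \<eta>\<^sub>P"
    using assms(5) unfolding power_decay_def by blast+
  note dqms = assms(1)[unfolded doubling_quasi_metric_space_def]
  obtain C\<^sub>D where C\<^sub>D: "C\<^sub>D > 0"
    and pos: "\<And>x r. r > 0 \<Longrightarrow> 0 < emeasure \<mu> (qball d x (2 * r))"
    and dbl: "\<And>x r. r > 0 \<Longrightarrow>
      emeasure \<mu> (qball d x (2 * r)) \<le> ennreal C\<^sub>D * emeasure \<mu> (qball d x r)"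
    using dqms by blast
  interpret power_decay_families d K M \<gamma> \<epsilon>\<^sub>P \<eta>\<^sub>P C\<^sub>D \<mu> \<Omega> S \<K>
  proof
    \<comment> \<open>Positivity is given for radii of the form \<open>2 * r\<close>; halving covers
      every radius.\<close>
    show "0 < emeasure \<mu> (qball d x r)" if "r > 0" for x r
      using pos[of "r / 2" x] that by simp
  qed (use dqms C\<^sub>D dbl assms params in auto)
  note K = K_ge_1
  obtain C where C: "C > 0"
    and har: "\<And>f x\<^sub>0 R A u. f \<in> S_finite_funs d \<mu> \<Omega> S \<Longrightarrow> R > 0 \<Longrightarrow> (A, u) \<in> \<K> f \<Longrightarrow>
     qball d x\<^sub>0 (4 * K\<^sup>2 * \<eta>\<^sub>P * R) \<subseteq> A \<Longrightarrow>
     \<exists>b. \<forall>y\<in>qball d x\<^sub>0 (2 * K * R). u y \<le> b \<Longrightarrow>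
     (SUP x\<in>qball d x\<^sub>0 R. ennreal (u x))
       \<le> ennreal C * ((INF x\<in>qball d x\<^sub>0 R. ennreal (u x)) + S (qball d x\<^sub>0 (4 * K\<^sup>2 * \<eta>\<^sub>P * R)) f)"
    using harnack by metis
  have "(SUP x\<in>qball d x\<^sub>0 R. ennreal (u x))
         \<le> ennreal C * ((INF x\<in>qball d x\<^sub>0 R. ennreal (u x)) + S (qball d x\<^sub>0 (\<eta> * R)) f)"
    if f: "f \<in> S_finite_funs d \<mu> \<Omega> S" and R: "R > 0" and u: "(A, u) \<in> \<K> f"
      and ball: "qball d x\<^sub>0 (\<eta> * R) \<subseteq> \<Omega>" "qball d x\<^sub>0 (\<eta> * R) \<subseteq> A"
      and lb: "locally_bounded_on d (qball d x\<^sub>0 (\<eta> * R)) u" for f x\<^sub>0 R A u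
  proof -
    \<comment> \<open>The first summand is the radius required by \<open>harnack\<close>. Since
      \<open>\<eta> * R\<close> is at least \<open>K * (2 * K * R + 2 * R)\<close>, each point
      within \<open>2 * K * R\<close> of the centre has its ball of radius \<open>2 * R\<close>
      inside the large ball, which is the uniform margin that local boundedness asks for.\<close>
    have eta: "\<eta> * R = 4 * K\<^sup>2 * \<eta>\<^sub>P * R + 2 * K * R"
      unfolding assms(6) by (simp add: power2_eq_square algebra_simps)
    have KR: "K * R > 0" using K R by simp
    have eta_ge: "2 * K\<^sup>2 * R + 2 * K * R \<le> \<eta> * R"
    proof -
      have "2 * K\<^sup>2 * R * 1 \<le> 2 * K\<^sup>2 * R * (2 * \<eta>\<^sub>P)"
        using R params by (intro mult_left_mono) auto
      then show ?thesis unfolding eta by (simp add: algebra_simps)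
    qed
    have small: "qball d x\<^sub>0 (4 * K\<^sup>2 * \<eta>\<^sub>P * R) \<subseteq> qball d x\<^sub>0 (\<eta> * R)"
      unfolding eta using KR by (intro qball_mono) simp
    have "2 * K * R \<le> \<eta> * R"
      using eta_ge R by (smt (verit) zero_le_power2 mult_nonneg_nonneg)
    then have "qball d x\<^sub>0 (2 * K * R) \<subseteq> qball d x\<^sub>0 (\<eta> * R)" by (rule qball_mono)
    moreover have "qball d y (2 * R) \<subseteq> qball d x\<^sub>0 (\<eta> * R)" if "y \<in> qball d x\<^sub>0 (2 * K * R)" for y
      by (rule qball_subset_qball[OF qd, of x\<^sub>0 y "2 * K * R"])
        (use that eta_ge in \<open>auto simp: qball_def power2_eq_square algebra_simps\<close>)
    moreover have "2 * R > 0" using R by simp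
    ultimately have "bounded (u ` qball d x\<^sub>0 (2 * K * R))"
      using lb unfolding locally_bounded_on_def by blast
    then have "\<exists>b. \<forall>y\<in>qball d x\<^sub>0 (2 * K * R). u y \<le> b"
      unfolding bounded_iff by (force simp: abs_le_iff)
    then have "(SUP x\<in>qball d x\<^sub>0 R. ennreal (u x))
       \<le> ennreal C * ((INF x\<in>qball d x\<^sub>0 R. ennreal (u x)) + S (qball d x\<^sub>0 (4 * K\<^sup>2 * \<eta>\<^sub>P * R)) f)"
      using har[OF f R u] small ball by blast
    also have "\<dots> \<le> ennreal C * ((INF x\<in>qball d x\<^sub>0 R. ennreal (u x)) + S (qball d x\<^sub>0 (\<eta> * R)) f)"
      using K R params small ball \<open>2 * K * R \<le> \<eta> * R\<close> KR
      by (intro mult_left_mono add_left_mono S_mono[OF f] qball_in_balls_in) auto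
    finally show ?thesis .
  qed
  then show ?thesis using C by blast
qed

end
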